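(* Let $G$ be a metric group and let $H$ be an Abelian metric group with a group metric. Let $f:G\to H$ be differentiable at $a\in G$. Then $f$ is continuous at $a$.
   Context: A metric group is a group with a metric for which multiplication and inversion are continuous. A metric $d$ on a metric group $(H,\ast,d)$ with identity $e_H$ is a group metric if: (1) $d(x \ast y, e_H) \le d(x,e_H)d(y,e_H)+d(x,e_H)+d(y,e_H)$ for all $x,y\in H$; (2) for each fixed $k \in H$ there is $c_k>0$ such that $d(x\ast k, y \ast k)\le c_k d(x,y)$ for all $x,y \in H$. For metric groups $G,H$ with metrics $d_G,d_H$, $\tilde{\mathrm{Hom}}(G;H)$ denotes the set of group homomorphisms $\phi:G\to H$ that are continuous at the identity $e\in G$, with the metric $\tilde d(\phi,\psi)=\sup_{t\in G}\frac{d_H(\phi[t],\psi[t])}{1+d_H(\phi[t],\psi[t])}$. A function $f:G\to H$ is differentiable at $a\in G$ if there exist a neighborhood $V_a$ of $a$ and a function $\phi_f:G\to\tilde{\mathrm{Hom}}(G;H)$ continuous at $a$ (with respect to $d_G$ and $\tilde d$) such that $f(x)\ast f(a)^{-1}=\phi_f(x)[xa^{-1}]$ for all $x\in V_a$. *)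

theory Defs
  imports "HOL-Analysis.Analysis" "HOL-Algebra.Group"
begin

locale metric_group = group G + Metric_space "carrier G" d
  for G :: "('a, 'm) monoid_scheme" (structure) and d :: "'a \<Rightarrow> 'a \<Rightarrow> real" +
  assumes continuous_mult:
    "continuous_map (prod_topology mtopology mtopology) mtopology (\<lambda>(x, y). x \<otimes> y)"
  and continuous_inv: "continuous_map mtopology mtopology (\<lambda>x. inv x)"

definition group_metric :: "('a, 'm) monoid_scheme \<Rightarrow> ('a \<Rightarrow> 'a \<Rightarrow> real) \<Rightarrow> bool" where
  "group_metric H d \<longleftrightarrow>
     (\<forall>x \<in> carrier H. \<forall>y \<in> carrier H.
        d (x \<otimes>\<^bsub>H\<^esub> y) \<one>\<^bsub>H\<^esub> \<le> d x \<one>\<^bsub>H\<^esub> * d y \<one>\<^bsub>H\<^esub> + d x \<one>\<^bsub>H\<^esub> + d y \<one>\<^bsub>H\<^esub>) \<and>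
     (\<forall>k \<in> carrier H. \<exists>c>0. \<forall>x \<in> carrier H. \<forall>y \<in> carrier H.
        d (x \<otimes>\<^bsub>H\<^esub> k) (y \<otimes>\<^bsub>H\<^esub> k) \<le> c * d x y)"

text \<open>
  Homomorphisms are taken to be extensional: otherwise two functions that agree on the
  carrier of \<open>G\<close> but differ outside it would be distinct points at distance zero.
\<close>

definition Hom_tilde ::
  "('a, 'm) monoid_scheme \<Rightarrow> ('a \<Rightarrow> 'a \<Rightarrow> real) \<Rightarrow>
   ('b, 'n) monoid_scheme \<Rightarrow> ('b \<Rightarrow> 'b \<Rightarrow> real) \<Rightarrow> ('a \<Rightarrow> 'b) set" where
  "Hom_tilde G dG H dH =
     {\<phi> \<in> hom G H \<inter> extensional (carrier G).
        topcontinuous_at (Metric_space.mtopology (carrier G) dG)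
          (Metric_space.mtopology (carrier H) dH) \<phi> \<one>\<^bsub>G\<^esub>}"

definition dist_tilde ::
  "('a, 'm) monoid_scheme \<Rightarrow> ('b \<Rightarrow> 'b \<Rightarrow> real) \<Rightarrow> ('a \<Rightarrow> 'b) \<Rightarrow> ('a \<Rightarrow> 'b) \<Rightarrow> real" where
  "dist_tilde G dH \<phi> \<psi> = (SUP t\<in>carrier G. dH (\<phi> t) (\<psi> t) / (1 + dH (\<phi> t) (\<psi> t)))"

definition differentiable_at_point ::
  "('a, 'm) monoid_scheme \<Rightarrow> ('a \<Rightarrow> 'a \<Rightarrow> real) \<Rightarrow>
   ('b, 'n) monoid_scheme \<Rightarrow> ('b \<Rightarrow> 'b \<Rightarrow> real) \<Rightarrow> ('a \<Rightarrow> 'b) \<Rightarrow> 'a \<Rightarrow> bool" where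
  "differentiable_at_point G dG H dH f a \<longleftrightarrow>
     (\<exists>V \<phi>. V \<subseteq> carrier G \<and>
        (\<exists>U. openin (Metric_space.mtopology (carrier G) dG) U \<and> a \<in> U \<and> U \<subseteq> V) \<and>
        \<phi> \<in> carrier G \<rightarrow> Hom_tilde G dG H dH \<and>
        topcontinuous_at (Metric_space.mtopology (carrier G) dG)
          (Metric_space.mtopology (Hom_tilde G dG H dH) (dist_tilde G dH)) \<phi> a \<and>
        (\<forall>x \<in> V. f x \<otimes>\<^bsub>H\<^esub> inv\<^bsub>H\<^esub> (f a) = \<phi> x (x \<otimes>\<^bsub>G\<^esub> inv\<^bsub>G\<^esub> a)))"

lemma Metric_space_Hom_tilde:
  assumes "metric_group G dG" and "metric_group H dH"
  shows "Metric_space (Hom_tilde G dG H dH) (dist_tilde G dH)"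
proof -
  interpret G: metric_group G dG by fact
  interpret H: metric_group H dH by fact
  let ?r = "\<lambda>s::real. s / (1 + s)"
  have r_nn: "0 \<le> ?r (dH u v)" for u v by simp
  have r_le: "?r (dH u v) \<le> 1" for u v
  proof -
    have "0 < 1 + dH u v" using H.nonneg[of u v] by linarith
    thus ?thesis by (simp add: divide_le_eq_1)
  qed
  have ne: "carrier G \<noteq> {}" by auto
  have bdd: "bdd_above ((\<lambda>t. ?r (dH (\<phi> t) (\<psi> t))) ` carrier G)" for \<phi> \<psi>
    using r_le by (intro bdd_aboveI[of _ 1]) auto
  have up: "?r (dH (\<phi> t) (\<psi> t)) \<le> dist_tilde G dH \<phi> \<psi>" if "t \<in> carrier G" for t \<phi> \<psi>
    unfolding dist_tilde_def using cSUP_upper[OF that bdd] by simp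
  have r_tri: "?r u \<le> ?r v + ?r w" if "0 \<le> u" "0 \<le> v" "0 \<le> w" "u \<le> v + w" for u v w :: real
  proof -
    have "?r u \<le> ?r (v + w)" using that by (simp add: field_simps)
    also have "\<dots> = v / (1 + v + w) + w / (1 + v + w)" by (simp add: add_divide_distrib algebra_simps)
    also have "\<dots> \<le> ?r v + ?r w" using that by (intro add_mono[OF divide_left_mono divide_left_mono]) auto
    finally show ?thesis .
  qed
  show ?thesis
  proof
    fix \<phi> \<psi>
    show "0 \<le> dist_tilde G dH \<phi> \<psi>" using up[OF G.one_closed] r_nn order_trans by blast
    show "dist_tilde G dH \<phi> \<psi> = dist_tilde G dH \<psi> \<phi>" by (simp add: dist_tilde_def H.commute)
  next
    fix \<phi> \<psi> assume *: "\<phi> \<in> Hom_tilde G dG H dH" "\<psi> \<in> Hom_tilde G dG H dH"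
    show "dist_tilde G dH \<phi> \<psi> = 0 \<longleftrightarrow> \<phi> = \<psi>"
    proof
      assume z: "dist_tilde G dH \<phi> \<psi> = 0"
      show "\<phi> = \<psi>"
      proof (rule extensionalityI[of _ "carrier G"])
        fix t assume t: "t \<in> carrier G"
        have "?r (dH (\<phi> t) (\<psi> t)) = 0"
          using up[OF t, of \<phi> \<psi>] r_nn[of "\<phi> t" "\<psi> t"] z by linarith
        hence "dH (\<phi> t) (\<psi> t) = 0"
          using H.nonneg[of "\<phi> t" "\<psi> t"] by (auto simp: divide_eq_0_iff)
        thus "\<phi> t = \<psi> t" using * t by (auto simp: Hom_tilde_def hom_def Pi_iff)
      qed (use * in \<open>auto simp: Hom_tilde_def\<close>)
    next
      assume "\<phi> = \<psi>"
      have "dH (\<psi> t) (\<psi> t) = 0" if "t \<in> carrier G" for t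
        using * that by (auto simp: Hom_tilde_def hom_def Pi_iff)
      then show "dist_tilde G dH \<phi> \<psi> = 0"
        using ne \<open>\<phi> = \<psi>\<close> by (simp add: dist_tilde_def)
    qed
  next
    fix \<phi> \<psi> \<theta>
    assume *: "\<phi> \<in> Hom_tilde G dG H dH" "\<psi> \<in> Hom_tilde G dG H dH" "\<theta> \<in> Hom_tilde G dG H dH"
    show "dist_tilde G dH \<phi> \<theta> \<le> dist_tilde G dH \<phi> \<psi> + dist_tilde G dH \<psi> \<theta>"
      unfolding dist_tilde_def[of _ _ \<phi> \<theta>]
    proof (rule cSUP_least[OF ne])
      fix t assume t: "t \<in> carrier G"
      have "dH (\<phi> t) (\<theta> t) \<le> dH (\<phi> t) (\<psi> t) + dH (\<psi> t) (\<theta> t)"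
        using * t by (intro H.triangle) (auto simp: Hom_tilde_def hom_def Pi_iff)
      from r_tri[OF H.nonneg H.nonneg H.nonneg this] up[OF t, of \<phi> \<psi>] up[OF t, of \<psi> \<theta>]
      show "?r (dH (\<phi> t) (\<theta> t)) \<le> dist_tilde G dH \<phi> \<psi> + dist_tilde G dH \<psi> \<theta>" by linarith
    qed
  qed
qed

end

theory Submission
  imports Defs
begin

text \<open>
  Write \<open>f x = \<phi> x y * f a\<close> with \<open>y = x * a\<^sup>-\<^sup>1\<close>. As \<open>x\<close> tends to \<open>a\<close>, the distance from
  \<open>\<phi> x y\<close> to \<open>\<phi> a y\<close> is controlled by the supremum metric, uniformly in \<open>y\<close>, while
  \<open>\<phi> a y\<close> tends to the identity because \<open>y\<close> does. Right translation by \<open>f a\<close> is Lipschitz,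
  so \<open>f x\<close> tends to \<open>f a\<close>.
\<close>

text \<open>The balls around \<open>f x\<close> form a neighbourhood base. The domain is an
  arbitrary topology and only the target is metric, so one criterion serves maps into
  \<open>H\<close> and into \<open>Hom_tilde\<close>.\<close>

lemma (in Metric_space) topcontinuous_at_mtopology_iff:
  "topcontinuous_at X mtopology f x \<longleftrightarrow>
     x \<in> topspace X \<and> f \<in> topspace X \<rightarrow> M \<and>
     (\<forall>\<epsilon>>0. \<exists>U. openin X U \<and> x \<in> U \<and> (\<forall>y\<in>U. d (f y) (f x) < \<epsilon>))"
  (is "?L \<longleftrightarrow> ?R")
proof
  assume L: ?L
  then have x: "x \<in> topspace X" and f: "f \<in> topspace X \<rightarrow> M"
    by (auto simp: topcontinuous_at_def)
  have "\<exists>U. openin X U \<and> x \<in> U \<and> (\<forall>y\<in>U. d (f y) (f x) < \<epsilon>)" if "\<epsilon> > 0" for \<epsilon>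
  proof -
    have "openin mtopology (mball (f x) \<epsilon>)" "f x \<in> mball (f x) \<epsilon>"
      using funcset_mem[OF f x] that by simp_all
    then obtain U where "openin X U" "x \<in> U" "\<forall>y\<in>U. f y \<in> mball (f x) \<epsilon>"
      using L unfolding topcontinuous_at_def by metis
    then show ?thesis
      by (auto simp: commute)
  qed
  with x f show ?R by blast
next
  assume R: ?R
  have "\<exists>U. openin X U \<and> x \<in> U \<and> (\<forall>y\<in>U. f y \<in> W)" if W: "openin mtopology W" "f x \<in> W" for W
  proof -
    obtain \<epsilon> where e: "\<epsilon> > 0" "mball (f x) \<epsilon> \<subseteq> W"
      using W unfolding openin_mtopology by blast
    then obtain U where U: "openin X U" "x \<in> U" "\<forall>y\<in>U. d (f y) (f x) < \<epsilon>"
      using R by blast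
    \<comment> \<open>Membership in \<open>mball\<close> includes membership in \<open>M\<close>,
      hence the appeal to \<open>U\<close> lying in \<open>topspace X\<close>.\<close>
    have "f y \<in> mball (f x) \<epsilon>" if "y \<in> U" for y
      using that U R openin_subset[OF U(1)] by (auto simp: commute Pi_iff)
    with U e show ?thesis by blast
  qed
  with R show ?L by (auto simp: topcontinuous_at_def)
qed

text \<open>The map s / (1 + s) is strictly increasing for s \<ge> 0, and the supremum dominates its
  value at every \<open>t\<close>. The threshold does not depend on \<open>t\<close>, which makes
  the control uniform.\<close>

lemma (in Metric_space) dist_less_of_dist_tilde_less:
  assumes "t \<in> carrier G" and "\<epsilon> > 0" and "dist_tilde G d \<phi> \<psi> < \<epsilon> / (1 + \<epsilon>)"
  shows "d (\<phi> t) (\<psi> t) < \<epsilon>"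
proof -
  let ?D = "\<lambda>t. d (\<phi> t) (\<psi> t)"
  have pos: "0 < 1 + ?D s" for s
    using nonneg[of "\<phi> s" "\<psi> s"] by linarith
  then have "bdd_above ((\<lambda>t. ?D t / (1 + ?D t)) ` carrier G)"
    by (intro bdd_aboveI[of _ 1]) (auto simp: divide_le_eq_1)
  then have "?D t / (1 + ?D t) \<le> dist_tilde G d \<phi> \<psi>"
    unfolding dist_tilde_def using assms(1) by (rule cSUP_upper[rotated])
  with assms(3) have "?D t / (1 + ?D t) < \<epsilon> / (1 + \<epsilon>)" by linarith
  then show ?thesis
    using pos[of t] \<open>\<epsilon> > 0\<close> by (simp add: field_simps)
qed

lemma (in metric_group) continuous_map_mult_right:
  assumes "k \<in> carrier G"
  shows "continuous_map mtopology mtopology (\<lambda>x. x \<otimes> k)"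
proof -
  have "continuous_map mtopology (prod_topology mtopology mtopology) (\<lambda>x. (x, k))"
    using assms by (simp add: continuous_map_pairedI)
  from continuous_map_compose[OF this continuous_mult] show ?thesis
    by (simp add: o_def)
qed

theorem theorem4p1:
  fixes G :: "('a, 'm) monoid_scheme" and dG :: "'a \<Rightarrow> 'a \<Rightarrow> real"
    and H :: "('b, 'n) monoid_scheme" and dH :: "'b \<Rightarrow> 'b \<Rightarrow> real"
    and f :: "'a \<Rightarrow> 'b" and a :: 'a
  assumes "metric_group G dG"
    and "metric_group H dH" and "comm_group H" and "group_metric H dH"
    and "f \<in> carrier G \<rightarrow> carrier H" and "a \<in> carrier G"
    and "differentiable_at_point G dG H dH f a"
  shows "topcontinuous_at (Metric_space.mtopology (carrier G) dG)
           (Metric_space.mtopology (carrier H) dH) f a"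
proof -
  interpret G: metric_group G dG by fact
  interpret H: metric_group H dH by fact
  interpret T: Metric_space "Hom_tilde G dG H dH" "dist_tilde G dH"
    using assms(1,2) by (rule Metric_space_Hom_tilde)
  note f = assms(5) and a = assms(6)
  obtain V \<phi> U0 where U0: "openin G.mtopology U0" "a \<in> U0" "U0 \<subseteq> V"
    and \<phi>: "\<phi> \<in> carrier G \<rightarrow> Hom_tilde G dG H dH"
    and \<phi>_cont: "topcontinuous_at G.mtopology T.mtopology \<phi> a"
    and f_eq: "\<forall>x\<in>V. f x \<otimes>\<^bsub>H\<^esub> inv\<^bsub>H\<^esub> (f a) = \<phi> x (x \<otimes>\<^bsub>G\<^esub> inv\<^bsub>G\<^esub> a)"
    using assms(7) unfolding differentiable_at_point_def by blast
  have hom: "\<phi> x \<in> hom G H" if "x \<in> carrier G" for x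
    using \<phi> that by (auto simp: Hom_tilde_def)
  have \<phi>a_one: "\<phi> a \<one>\<^bsub>G\<^esub> = \<one>\<^bsub>H\<^esub>"
    using hom[OF a] by (rule hom_one) unfold_locales
  have \<phi>a_cont: "topcontinuous_at G.mtopology H.mtopology (\<phi> a) \<one>\<^bsub>G\<^esub>"
    using \<phi> a by (auto simp: Hom_tilde_def)
  have fa: "f a \<in> carrier H" using f a by blast
  \<comment> \<open>Condition (2) of a group metric at \<open>k = f a\<close>: right translation by
    \<open>f a\<close> is Lipschitz.\<close>
  obtain c where c: "c > 0"
    "\<And>x y. x \<in> carrier H \<Longrightarrow> y \<in> carrier H \<Longrightarrow>
       dH (x \<otimes>\<^bsub>H\<^esub> f a) (y \<otimes>\<^bsub>H\<^esub> f a) \<le> c * dH x y"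
    using assms(4) fa unfolding group_metric_def by meson
  have "\<exists>U. openin G.mtopology U \<and> a \<in> U \<and> (\<forall>x\<in>U. dH (f x) (f a) < \<epsilon>)" if "\<epsilon> > 0" for \<epsilon>
  proof -
    \<comment> \<open>Two distances below \<open>\<delta>\<close> will be added and then scaled by
      \<open>c\<close>.\<close>
    define \<delta> where "\<delta> = \<epsilon> / (2 * c)"
    have \<delta>: "\<delta> > 0" "c * (\<delta> + \<delta>) = \<epsilon>" using that c(1) by (auto simp: \<delta>_def)
    then have "\<delta> / (1 + \<delta>) > 0" by simp
    then obtain U1 where U1: "openin G.mtopology U1" "a \<in> U1"
      "\<And>x. x \<in> U1 \<Longrightarrow> dist_tilde G dH (\<phi> x) (\<phi> a) < \<delta> / (1 + \<delta>)"
      using \<phi>_cont unfolding T.topcontinuous_at_mtopology_iff by meson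
    obtain W where W: "openin G.mtopology W" "\<one>\<^bsub>G\<^esub> \<in> W"
      "\<And>y. y \<in> W \<Longrightarrow> dH (\<phi> a y) \<one>\<^bsub>H\<^esub> < \<delta>"
      using \<phi>a_cont \<open>\<delta> > 0\<close> unfolding H.topcontinuous_at_mtopology_iff \<phi>a_one by meson
    \<comment> \<open>Pulling \<open>W\<close> back along right translation by the inverse of
      \<open>a\<close> turns a neighbourhood of the identity into one of \<open>a\<close>.\<close>
    define U2 where "U2 = {x \<in> carrier G. x \<otimes>\<^bsub>G\<^esub> inv\<^bsub>G\<^esub> a \<in> W}"
    have U2: "openin G.mtopology U2"
      using openin_continuous_map_preimage[OF G.continuous_map_mult_right W(1), of "inv\<^bsub>G\<^esub> a"] a
      by (simp add: U2_def)
    have "dH (f x) (f a) < \<epsilon>" if x: "x \<in> U0 \<inter> U1 \<inter> U2" for x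
    proof -
      define y where "y = x \<otimes>\<^bsub>G\<^esub> inv\<^bsub>G\<^esub> a"
      have xG: "x \<in> carrier G" and yG: "y \<in> carrier G" and yW: "y \<in> W"
        using x a by (auto simp: U2_def y_def)
      have mem: "\<phi> x y \<in> carrier H" "\<phi> a y \<in> carrier H" "f x \<in> carrier H"
        using hom[OF xG] hom[OF a] f xG yG by (auto simp: hom_def)
      have "f x \<otimes>\<^bsub>H\<^esub> inv\<^bsub>H\<^esub> (f a) = \<phi> x y"
        using f_eq U0 x by (auto simp: y_def)
      then have "f x = \<phi> x y \<otimes>\<^bsub>H\<^esub> f a"
        using mem fa H.inv_solve_right' by blast
      \<comment> \<open>Read \<open>f a\<close> as the identity translated by
        \<open>f a\<close>.\<close>
      then have "dH (f x) (f a) \<le> c * dH (\<phi> x y) \<one>\<^bsub>H\<^esub>"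
        using c(2)[OF mem(1) H.one_closed] fa by simp
      \<comment> \<open>Although \<open>y\<close> moves with \<open>x\<close>, the first term is
        small by uniformity; the second only involves the fixed homomorphism
        \<open>\<phi> a\<close>.\<close>
      also have "dH (\<phi> x y) \<one>\<^bsub>H\<^esub> \<le> dH (\<phi> x y) (\<phi> a y) + dH (\<phi> a y) \<one>\<^bsub>H\<^esub>"
        using mem by (intro H.triangle) auto
      also have "\<dots> < \<delta> + \<delta>"
        using H.dist_less_of_dist_tilde_less[OF yG \<open>\<delta> > 0\<close> U1(3)] W(3)[OF yW] x
        by (intro add_strict_mono) auto
      \<comment> \<open>Positivity of \<open>c\<close> justifies replacing the factor after
        \<open>c\<close> by its bounds.\<close>
      finally show ?thesis using c(1) \<delta>(2) by simp
    qed
    moreover have "openin G.mtopology (U0 \<inter> U1 \<inter> U2)" "a \<in> U0 \<inter> U1 \<inter> U2"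
      using U0 U1 U2 W(2) a by (auto simp: U2_def)
    ultimately show ?thesis by blast
  qed
  then show ?thesis
    unfolding H.topcontinuous_at_mtopology_iff using f a by auto
qed

end
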